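(* There is no infinite reduction sequence starting from any well-typed t-closed e-term of the ptq-calculus.
   Context: The ptq-calculus. Intuitionistic types $A::=X\mid A\to A$; for each $A$ types $A^{\mathsf p},A^{\mathsf t},A^{\mathsf q}$. Terms: p-variables; a t-variable $k$; a constant $*$. p-terms $p::=x\mid\lambda\langle x,k\rangle.u\mid\lambda k.u$; t-terms $t::=*\mid k\mid\langle p,t\rangle\mid\lambda x.u$; q-terms $q::=\overline{\lambda}k.u$; e-terms $u::=t;p\mid q\,t$. $\lambda\langle x,k\rangle$ binds $x,k$; $\lambda k,\overline\lambda k$ bind $k$; $\lambda x$ binds $x$; terms modulo $\alpha$-conversion. A term is t-closed if it has no free t-variable; for $u$ with $k$ free, $u_*:=u[*/k]$. Typing: environments $\Gamma$ or $\Gamma\rhd\delta$, $\Gamma$ a set of distinct p-variables with proof types, $\delta$ either $k:A^{\mathsf t}$ or $*:A^{\mathsf t}$. Rules: $\Gamma,x:A^{\mathsf p}\vdash x:A^{\mathsf p}$; $\Gamma\rhd k:A^{\mathsf t}\vdash k:A^{\mathsf t}$; $\Gamma\rhd *:A^{\mathsf t}\vdash *:A^{\mathsf t}$; $\Gamma,x:A^{\mathsf p}\rhd k:B^{\mathsf t}\vdash u\Rightarrow\Gamma\vdash\lambda\langle x,k\rangle.u:(A\to B)^{\mathsf p}$; $\Gamma\vdash p:A^{\mathsf p},\ \Gamma\rhd\delta\vdash t:B^{\mathsf t}\Rightarrow\Gamma\rhd\delta\vdash\langle p,t\rangle:(A\to B)^{\mathsf t}$; $\Gamma\rhd k:A^{\mathsf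 t}\vdash u\Rightarrow\Gamma\vdash\lambda k.u:A^{\mathsf p}$; $\Gamma,x:A^{\mathsf p}\rhd\delta\vdash u\Rightarrow\Gamma\rhd\delta\vdash\lambda x.u:A^{\mathsf t}$; $\Gamma\rhd k:A^{\mathsf t}\vdash u\Rightarrow\Gamma\vdash\overline\lambda k.u:A^{\mathsf q}$; $\Gamma\vdash p:A^{\mathsf p},\ \Gamma\rhd\delta\vdash t:A^{\mathsf t}\Rightarrow\Gamma\rhd\delta\vdash t;p$; $\Gamma\vdash q:A^{\mathsf q},\ \Gamma\rhd\delta\vdash t:A^{\mathsf t}\Rightarrow\Gamma\rhd\delta\vdash q\,t$. Reduction (on t-closed e-terms, only at top level; no reduction under binders or inside pairs): $*;\lambda k.u\to u[*/k]$; $\langle p,t_*\rangle;\lambda k.u\to u[\langle p,t_*\rangle/k]$; $\langle p,t_*\rangle;\lambda\langle x,k\rangle.u\to u[p/x,t_*/k]$; $(\lambda x.u_* );p\to u_*[p/x]$; $(\overline\lambda k.u)\,t_*\to u[t_*/k]$. *)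

theory Defs
  imports Main
begin

datatype ty = Atom nat | Arrow ty ty

text \<open>
  Terms modulo alpha-conversion. The p-variables are de Bruijn indices, counting only the binders
  of p-variables (\<open>PLamXK\<close> and \<open>TLam\<close>). There is a single t-variable \<open>k\<close>, so an occurrence
  \<open>TVar\<close> needs no index: it refers to the innermost enclosing \<open>PLamXK\<close>, \<open>PLamK\<close> or \<open>QLam\<close>, and is
  free if there is none. Hence \<open>k\<close> is never free in a p-term or a q-term.

  \<open>PLamXK u\<close> is \<open>\<lambda>\<langle>x,k\<rangle>.u\<close>, \<open>PLamK u\<close> is \<open>\<lambda>k.u\<close>, \<open>TLam u\<close> is \<open>\<lambda>x.u\<close>, \<open>QLam u\<close> is the overlined
  \<open>\<lambda>k.u\<close>, \<open>Cut t p\<close> is \<open>t;p\<close> and \<open>App q t\<close> is \<open>q t\<close>.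
\<close>

datatype pterm = PVar nat | PLamXK eterm | PLamK eterm
  and tterm = Star | TVar | TPair pterm tterm | TLam eterm
  and qterm = QLam eterm
  and eterm = Cut tterm pterm | App qterm tterm

primrec k_free_t :: "tterm \<Rightarrow> bool" and k_free_e :: "eterm \<Rightarrow> bool" where
  "k_free_t Star \<longleftrightarrow> False"
| "k_free_t TVar \<longleftrightarrow> True"
| "k_free_t (TPair p t) \<longleftrightarrow> k_free_t t"
| "k_free_t (TLam u) \<longleftrightarrow> k_free_e u"
| "k_free_e (Cut t p) \<longleftrightarrow> k_free_t t"
| "k_free_e (App q t) \<longleftrightarrow> k_free_t t"

definition t_closed :: "eterm \<Rightarrow> bool" where
  "t_closed u \<longleftrightarrow> \<not> k_free_e u"

definition up_ren :: "(nat \<Rightarrow> nat) \<Rightarrow> nat \<Rightarrow> nat" where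
  "up_ren r = case_nat 0 (\<lambda>i. Suc (r i))"

primrec ren_p :: "(nat \<Rightarrow> nat) \<Rightarrow> pterm \<Rightarrow> pterm"
  and ren_t :: "(nat \<Rightarrow> nat) \<Rightarrow> tterm \<Rightarrow> tterm"
  and ren_q :: "(nat \<Rightarrow> nat) \<Rightarrow> qterm \<Rightarrow> qterm"
  and ren_e :: "(nat \<Rightarrow> nat) \<Rightarrow> eterm \<Rightarrow> eterm" where
  "ren_p r (PVar i) = PVar (r i)"
| "ren_p r (PLamXK u) = PLamXK (ren_e (up_ren r) u)"
| "ren_p r (PLamK u) = PLamK (ren_e r u)"
| "ren_t r Star = Star"
| "ren_t r TVar = TVar"
| "ren_t r (TPair p t) = TPair (ren_p r p) (ren_t r t)"
| "ren_t r (TLam u) = TLam (ren_e (up_ren r) u)"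
| "ren_q r (QLam u) = QLam (ren_e r u)"
| "ren_e r (Cut t p) = Cut (ren_t r t) (ren_p r p)"
| "ren_e r (App q t) = App (ren_q r q) (ren_t r t)"

definition up_sub :: "(nat \<Rightarrow> pterm) \<Rightarrow> nat \<Rightarrow> pterm" where
  "up_sub s = case_nat (PVar 0) (\<lambda>i. ren_p Suc (s i))"

text \<open>
  Simultaneous capture-avoiding substitution of \<open>s i\<close> for every p-variable \<open>i\<close> and of the t-term \<open>c\<close>
  for \<open>k\<close>. The latter does not act on p-terms and q-terms, where \<open>k\<close> is not free.
\<close>

primrec sub_p :: "(nat \<Rightarrow> pterm) \<Rightarrow> pterm \<Rightarrow> pterm"
  and sub_t :: "(nat \<Rightarrow> pterm) \<Rightarrow> tterm \<Rightarrow> tterm \<Rightarrow> tterm"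
  and sub_q :: "(nat \<Rightarrow> pterm) \<Rightarrow> qterm \<Rightarrow> qterm"
  and sub_e :: "(nat \<Rightarrow> pterm) \<Rightarrow> tterm \<Rightarrow> eterm \<Rightarrow> eterm" where
  "sub_p s (PVar i) = s i"
| "sub_p s (PLamXK u) = PLamXK (sub_e (up_sub s) TVar u)"
| "sub_p s (PLamK u) = PLamK (sub_e s TVar u)"
| "sub_t s c Star = Star"
| "sub_t s c TVar = c"
| "sub_t s c (TPair p t) = TPair (sub_p s p) (sub_t s c t)"
| "sub_t s c (TLam u) = TLam (sub_e (up_sub s) (ren_t Suc c) u)"
| "sub_q s (QLam u) = QLam (sub_e s TVar u)"
| "sub_e s c (Cut t p) = Cut (sub_t s c t) (sub_p s p)"
| "sub_e s c (App q t) = App (sub_q s q) (sub_t s c t)"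

definition inst_k :: "tterm \<Rightarrow> eterm \<Rightarrow> eterm" where
  "inst_k c u = sub_e PVar c u"

text \<open>
  In the next two definitions \<open>x\<close> is the p-variable with index \<open>0\<close>, whose binder is being removed.
\<close>

definition inst_x :: "pterm \<Rightarrow> eterm \<Rightarrow> eterm" where
  "inst_x p u = sub_e (case_nat p PVar) TVar u"

definition inst_xk :: "pterm \<Rightarrow> tterm \<Rightarrow> eterm \<Rightarrow> eterm" where
  "inst_xk p c u = sub_e (case_nat p PVar) c u"

definition star_t :: "tterm \<Rightarrow> tterm" where
  "star_t t = sub_t PVar Star t"

definition star_e :: "eterm \<Rightarrow> eterm" where
  "star_e u = sub_e PVar Star u"

lemma up_sub_PVar: "up_sub PVar = PVar"
  by (auto simp: up_sub_def split: nat.splits)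

lemma sub_PVar_TVar:
  "sub_p PVar p = p" "sub_t PVar TVar t = t" "sub_q PVar q = q" "sub_e PVar TVar u = u"
  by (induction p and t and q and u) (simp_all add: up_sub_PVar)

lemma star_image_aux:
  "sub_p PVar p = p" "\<not> k_free_t (star_t t) \<and> (\<not> k_free_t t \<longrightarrow> (\<exists>t'. k_free_t t' \<and> t = star_t t'))"
  "sub_q PVar q = q" "\<not> k_free_e (star_e u) \<and> (\<not> k_free_e u \<longrightarrow> (\<exists>u'. k_free_e u' \<and> u = star_e u'))"
proof (induction p and t and q and u)
  case Star
  show ?case by (auto simp: star_t_def intro!: exI[of _ TVar])
next
  case (TPair p t)
  then show ?case
    by (auto simp: star_t_def sub_PVar_TVar) (metis k_free_t.simps(3) sub_t.simps(3) sub_PVar_TVar(1))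
next
  case (TLam u)
  then show ?case
    by (auto simp: star_t_def star_e_def up_sub_PVar) (metis k_free_t.simps(4) sub_t.simps(4) ren_t.simps(1) up_sub_PVar)
next
  case (Cut t p)
  then show ?case
    by (auto simp: star_t_def star_e_def sub_PVar_TVar) (metis k_free_e.simps(1) sub_e.simps(1) sub_PVar_TVar(1))
next
  case (App q t)
  then show ?case
    by (auto simp: star_t_def star_e_def sub_PVar_TVar) (metis k_free_e.simps(2) sub_e.simps(2) sub_PVar_TVar(3))
qed (auto simp: star_t_def sub_PVar_TVar up_sub_PVar)

text \<open>
  The t-terms \<open>t\<^sub>*\<close> and e-terms \<open>u\<^sub>*\<close> with \<open>k\<close> free in \<open>t\<close>, \<open>u\<close> are precisely the t-closed ones. So the
  form of the redexes in \<open>red\<close> below only says that reduction acts on t-closed e-terms.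
\<close>

lemma t_closed_iff_star_t: "\<not> k_free_t t \<longleftrightarrow> (\<exists>t'. k_free_t t' \<and> t = star_t t')"
  and t_closed_iff_star_e: "\<not> k_free_e u \<longleftrightarrow> (\<exists>u'. k_free_e u' \<and> u = star_e u')"
  using star_image_aux by metis+

datatype tdecl = DeclK ty | DeclStar ty

text \<open>
  An environment of p-variables is the list of their types, indexed by the de Bruijn indices.
  The four predicates correspond to the judgements \<open>\<Gamma> \<turnstile> p : A\<^sup>p\<close>, \<open>\<Gamma> \<rhd> \<delta> \<turnstile> t : A\<^sup>t\<close>, \<open>\<Gamma> \<turnstile> q : A\<^sup>q\<close>
  and \<open>\<Gamma> \<rhd> \<delta> \<turnstile> u\<close>.
\<close>

inductive p_typing :: "ty list \<Rightarrow> pterm \<Rightarrow> ty \<Rightarrow> bool"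
  and t_typing :: "ty list \<Rightarrow> tdecl \<Rightarrow> tterm \<Rightarrow> ty \<Rightarrow> bool"
  and q_typing :: "ty list \<Rightarrow> qterm \<Rightarrow> ty \<Rightarrow> bool"
  and e_typing :: "ty list \<Rightarrow> tdecl \<Rightarrow> eterm \<Rightarrow> bool" where
  ty_PVar: "i < length \<Gamma> \<Longrightarrow> p_typing \<Gamma> (PVar i) (\<Gamma> ! i)"
| ty_TVar: "t_typing \<Gamma> (DeclK A) TVar A"
| ty_Star: "t_typing \<Gamma> (DeclStar A) Star A"
| ty_PLamXK: "e_typing (A # \<Gamma>) (DeclK B) u \<Longrightarrow> p_typing \<Gamma> (PLamXK u) (Arrow A B)"
| ty_TPair: "p_typing \<Gamma> p A \<Longrightarrow> t_typing \<Gamma> \<delta> t B \<Longrightarrow> t_typing \<Gamma> \<delta> (TPair p t) (Arrow A B)"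
| ty_PLamK: "e_typing \<Gamma> (DeclK A) u \<Longrightarrow> p_typing \<Gamma> (PLamK u) A"
| ty_TLam: "e_typing (A # \<Gamma>) \<delta> u \<Longrightarrow> t_typing \<Gamma> \<delta> (TLam u) A"
| ty_QLam: "e_typing \<Gamma> (DeclK A) u \<Longrightarrow> q_typing \<Gamma> (QLam u) A"
| ty_Cut: "p_typing \<Gamma> p A \<Longrightarrow> t_typing \<Gamma> \<delta> t A \<Longrightarrow> e_typing \<Gamma> \<delta> (Cut t p)"
| ty_App: "q_typing \<Gamma> q A \<Longrightarrow> t_typing \<Gamma> \<delta> t A \<Longrightarrow> e_typing \<Gamma> \<delta> (App q t)"

definition well_typed :: "eterm \<Rightarrow> bool" where
  "well_typed u \<longleftrightarrow> (\<exists>\<Gamma> \<delta>. e_typing \<Gamma> \<delta> u)"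

inductive red :: "eterm \<Rightarrow> eterm \<Rightarrow> bool" where
  red_star: "red (Cut Star (PLamK u)) (inst_k Star u)"
| red_pair_k: "k_free_t t \<Longrightarrow>
    red (Cut (TPair p (star_t t)) (PLamK u)) (inst_k (TPair p (star_t t)) u)"
| red_pair_xk: "k_free_t t \<Longrightarrow>
    red (Cut (TPair p (star_t t)) (PLamXK u)) (inst_xk p (star_t t) u)"
| red_lam_x: "k_free_e u \<Longrightarrow>
    red (Cut (TLam (star_e u)) p) (inst_x p (star_e u))"
| red_q: "k_free_t t \<Longrightarrow>
    red (App (QLam u) (star_t t)) (inst_k (star_t t) u)"

end

(* Reducibility by orthogonality. By recursion on the type A one fixes a set of t-values: the constant
   and, at an arrow type, the pairs of a reducible p-term and a reducible t-term. A p-term is reducible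
   if it is strongly normalizing against all t-values, a t-term if it is so against all reducible
   p-terms. A cut of lambda x.u against lambda k.u' gives priority to lambda x, which is why reducibility
   of p-terms must be tested on values only. Since each redex has just one reduct, reducibility is closed
   under head expansion, and every typed term is reducible under reducible substitutions. *)
theory Submission
  imports Defs
begin

section \<open>Composition of substitutions\<close>

lemma up_ren_0 [simp]: "up_ren r 0 = 0"
  and up_ren_Suc [simp]: "up_ren r (Suc i) = Suc (r i)"
  by (simp_all add: up_ren_def)

lemma up_sub_0 [simp]: "up_sub s 0 = PVar 0"
  and up_sub_Suc [simp]: "up_sub s (Suc i) = ren_p Suc (s i)"
  by (simp_all add: up_sub_def)

lemma up_ren_comp: "up_ren (\<lambda>i. r' (r i)) = (\<lambda>i. up_ren r' (up_ren r i))"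
  by (auto simp: up_ren_def fun_eq_iff split: nat.split)

lemma up_sub_ren: "up_sub (\<lambda>i. s (r i)) = (\<lambda>i. up_sub s (up_ren r i))"
  by (auto simp: up_ren_def up_sub_def fun_eq_iff split: nat.split)

text \<open>Composition laws build on one another because lifting renames by \<open>Suc\<close>:
  under binders \<open>ren_sub\<close> needs \<open>ren_ren\<close>, and \<open>sub_sub\<close>
  needs \<open>sub_ren\<close> and \<open>ren_sub\<close>.\<close>

lemma ren_ren:
  "ren_p r' (ren_p r p) = ren_p (\<lambda>i. r' (r i)) p"
  "ren_t r' (ren_t r t) = ren_t (\<lambda>i. r' (r i)) t"
  "ren_q r' (ren_q r q) = ren_q (\<lambda>i. r' (r i)) q"
  "ren_e r' (ren_e r u) = ren_e (\<lambda>i. r' (r i)) u"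
  by (induction p and t and q and u arbitrary: r r' and r r' and r r' and r r')
    (simp_all add: up_ren_comp[symmetric])

lemma sub_ren:
  "sub_p s (ren_p r p) = sub_p (\<lambda>i. s (r i)) p"
  "sub_t s c (ren_t r t) = sub_t (\<lambda>i. s (r i)) c t"
  "sub_q s (ren_q r q) = sub_q (\<lambda>i. s (r i)) q"
  "sub_e s c (ren_e r u) = sub_e (\<lambda>i. s (r i)) c u"
  by (induction p and t and q and u arbitrary: r s and r s c and r s and r s c)
    (simp_all add: up_sub_ren[symmetric])

lemma up_sub_ren_p: "up_sub (\<lambda>i. ren_p r (s i)) = (\<lambda>i. ren_p (up_ren r) (up_sub s i))"
  by (auto simp: up_sub_def ren_ren fun_eq_iff split: nat.split)

lemma ren_sub:
  "ren_p r (sub_p s p) = sub_p (\<lambda>i. ren_p r (s i)) p"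
  "ren_t r (sub_t s c t) = sub_t (\<lambda>i. ren_p r (s i)) (ren_t r c) t"
  "ren_q r (sub_q s q) = sub_q (\<lambda>i. ren_p r (s i)) q"
  "ren_e r (sub_e s c u) = sub_e (\<lambda>i. ren_p r (s i)) (ren_t r c) u"
  by (induction p and t and q and u arbitrary: r s and r s c and r s and r s c)
    (simp_all add: up_sub_ren_p ren_ren)

lemma up_sub_sub_p: "up_sub (\<lambda>i. sub_p s' (s i)) = (\<lambda>i. sub_p (up_sub s') (up_sub s i))"
  by (auto simp: up_sub_def sub_ren ren_sub fun_eq_iff split: nat.split)

lemma sub_sub:
  "sub_p s' (sub_p s p) = sub_p (\<lambda>i. sub_p s' (s i)) p"
  "sub_t s' c' (sub_t s c t) = sub_t (\<lambda>i. sub_p s' (s i)) (sub_t s' c' c) t"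
  "sub_q s' (sub_q s q) = sub_q (\<lambda>i. sub_p s' (s i)) q"
  "sub_e s' c' (sub_e s c u) = sub_e (\<lambda>i. sub_p s' (s i)) (sub_t s' c' c) u"
  by (induction p and t and q and u arbitrary: s s' and s s' c c' and s s' and s s' c c')
    (simp_all add: up_sub_sub_p sub_ren ren_sub)

lemma sub_case_nat_up_sub: "(\<lambda>i. sub_p (case_nat p PVar) (up_sub s i)) = case_nat p s"
  by (auto simp: up_sub_def sub_ren sub_PVar_TVar fun_eq_iff split: nat.split)

text \<open>With the next two lemmas: contracting a redex whose body was already substituted amounts
  to one simultaneous substitution, the form that an induction hypothesis about the body
  covers.\<close>

lemma inst_k_sub: "inst_k c (sub_e s TVar u) = sub_e s c u"
  by (simp add: inst_k_def sub_sub sub_PVar_TVar)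

lemma inst_x_sub: "inst_x p (sub_e (up_sub s) (ren_t Suc c) u) = sub_e (case_nat p s) c u"
  by (simp add: inst_x_def sub_sub sub_ren sub_PVar_TVar sub_case_nat_up_sub)

lemma inst_xk_sub: "inst_xk p c (sub_e (up_sub s) TVar u) = sub_e (case_nat p s) c u"
  by (simp add: inst_xk_def sub_sub sub_case_nat_up_sub)

section \<open>Strong normalization and head expansion\<close>

abbreviation SN :: "eterm \<Rightarrow> bool" where
  "SN \<equiv> Wellfounded.accp (\<lambda>v u. red u v)"

lemma SN_no_infinite_reduction:
  assumes "SN u"
  shows "\<not> (\<exists>f :: nat \<Rightarrow> eterm. f 0 = u \<and> (\<forall>i. red (f i) (f (Suc i))))"
  using assms
proof (induction rule: accp_induct_rule)
  case (1 u)
  show ?case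
  proof
    assume "\<exists>f :: nat \<Rightarrow> eterm. f 0 = u \<and> (\<forall>i. red (f i) (f (Suc i)))"
    then obtain f :: "nat \<Rightarrow> eterm" where f: "f 0 = u" "\<forall>i. red (f i) (f (Suc i))"
      by blast
    then have "red u (f 1)"
      by (metis One_nat_def)
    with 1 have "\<not> (\<exists>g :: nat \<Rightarrow> eterm. g 0 = f 1 \<and> (\<forall>i. red (g i) (g (Suc i))))"
      by blast
    with f show False
      by (auto dest: spec[of _ "\<lambda>i. f (Suc i)"])
  qed
qed

inductive_cases red_Cut_E: "red (Cut t p) v"
inductive_cases red_App_E: "red (App q t) v"

text \<open>Against a variable only \<open>TLam\<close> can fire, so these cuts are stuck.\<close>

lemma SN_Cut_PVar: "t = Star \<or> t = TVar \<or> (\<exists>p' t'. t = TPair p' t') \<Longrightarrow> SN (Cut t (PVar i))"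
  by (rule accp.accI) (auto elim!: red_Cut_E)

lemma SN_Cut_TVar: "SN (Cut TVar p)"
  by (rule accp.accI) (auto elim!: red_Cut_E)

lemma SN_Cut_Star_PLamXK: "SN (Cut Star (PLamXK u))"
  by (rule accp.accI) (auto elim!: red_Cut_E)

text \<open>The shape of \<open>t\<close> rules out \<open>TLam\<close>, whose cut contracts the
  other way, by \<open>red_lam_x\<close>. If the pair is not t-closed, the cut has no reduct at
  all.\<close>

lemma SN_Cut_PLamK:
  "SN (inst_k t u) \<Longrightarrow> t = Star \<or> (\<exists>p' t'. t = TPair p' t') \<Longrightarrow> SN (Cut t (PLamK u))"
  by (rule accp.accI) (auto elim!: red_Cut_E)

lemma SN_Cut_PLamXK: "SN (inst_xk p t u) \<Longrightarrow> SN (Cut (TPair p t) (PLamXK u))"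
  by (rule accp.accI) (auto elim!: red_Cut_E)

lemma SN_Cut_TLam: "SN (inst_x p u) \<Longrightarrow> SN (Cut (TLam u) p)"
  by (rule accp.accI) (auto elim!: red_Cut_E)

lemma SN_App_QLam: "SN (inst_k t u) \<Longrightarrow> SN (App (QLam u) t)"
  by (rule accp.accI) (auto elim!: red_App_E)

section \<open>Reducibility\<close>

definition orth_p :: "tterm set \<Rightarrow> pterm set" where
  "orth_p T = {p. \<forall>t\<in>T. SN (Cut t p)}"

definition orth_t :: "pterm set \<Rightarrow> tterm set" where
  "orth_t P = {t. \<forall>p\<in>P. SN (Cut t p)}"

text \<open>\<open>Star\<close> is a value at every type because \<open>ty_Star\<close> gives it any
  type. No \<open>TLam\<close> is a value; these enter only through the biorthogonal, also in the
  second component of a pair.\<close>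

primrec val_t :: "ty \<Rightarrow> tterm set" where
  "val_t (Atom n) = {Star}"
| "val_t (Arrow A B) = {Star} \<union>
    {TPair p t | p t. p \<in> orth_p (val_t A) \<and> t \<in> orth_t (orth_p (val_t B))}"

definition reducible_p :: "ty \<Rightarrow> pterm set" where
  "reducible_p A = orth_p (val_t A)"

definition reducible_t :: "ty \<Rightarrow> tterm set" where
  "reducible_t A = orth_t (reducible_p A)"

definition reducible_q :: "ty \<Rightarrow> qterm set" where
  "reducible_q A = {q. \<forall>t\<in>reducible_t A. SN (App q t)}"

lemma val_t_Arrow: "val_t (Arrow A B) = {Star} \<union>
    {TPair p t | p t. p \<in> reducible_p A \<and> t \<in> reducible_t B}"
  by (simp add: reducible_p_def reducible_t_def)

lemma val_t_cases:
  assumes "t \<in> val_t A"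
  shows "t = Star \<or> (\<exists>p' t'. t = TPair p' t')"
  using assms by (cases A) auto

text \<open>Every set is contained in its biorthogonal.\<close>

lemma val_t_subset_reducible_t: "val_t A \<subseteq> reducible_t A"
  by (auto simp: reducible_t_def reducible_p_def orth_t_def orth_p_def)

lemma Star_reducible_t: "Star \<in> reducible_t A"
proof -
  have "Star \<in> val_t A"
    by (cases A) auto
  then show ?thesis
    using val_t_subset_reducible_t by blast
qed

lemma TVar_reducible_t: "TVar \<in> reducible_t A"
  by (simp add: reducible_t_def orth_t_def SN_Cut_TVar)

lemma PVar_reducible_p: "PVar i \<in> reducible_p A"
  using val_t_cases by (auto simp: reducible_p_def orth_p_def intro!: SN_Cut_PVar)

lemma SN_Cut_reducible: "t \<in> reducible_t A \<Longrightarrow> p \<in> reducible_p A \<Longrightarrow> SN (Cut t p)"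
  by (simp add: reducible_t_def orth_t_def)

definition reducible_env :: "ty list \<Rightarrow> (nat \<Rightarrow> pterm) \<Rightarrow> bool" where
  "reducible_env \<Gamma> s \<longleftrightarrow> (\<forall>i<length \<Gamma>. s i \<in> reducible_p (\<Gamma> ! i))"

text \<open>Under \<open>DeclStar\<close> the t-variable cannot occur free, so whatever replaces it
  is harmless.\<close>

fun reducible_decl :: "tdecl \<Rightarrow> tterm \<Rightarrow> bool" where
  "reducible_decl (DeclK A) c \<longleftrightarrow> c \<in> reducible_t A"
| "reducible_decl (DeclStar A) c \<longleftrightarrow> True"

lemma reducible_env_Cons:
  "reducible_env \<Gamma> s \<Longrightarrow> p \<in> reducible_p A \<Longrightarrow> reducible_env (A # \<Gamma>) (case_nat p s)"
  by (auto simp: reducible_env_def nth_Cons split: nat.split)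

text \<open>Induction on typing: in each binder case the contracted redex is the body under an
  extended reducible substitution, and head expansion concludes.\<close>

theorem typing_reducible:
  "p_typing \<Gamma> p A \<Longrightarrow> (\<And>s. reducible_env \<Gamma> s \<Longrightarrow> sub_p s p \<in> reducible_p A)"
  "t_typing \<Gamma> \<delta> t A \<Longrightarrow>
    (\<And>s c. reducible_env \<Gamma> s \<Longrightarrow> reducible_decl \<delta> c \<Longrightarrow> sub_t s c t \<in> reducible_t A)"
  "q_typing \<Gamma> q A \<Longrightarrow> (\<And>s. reducible_env \<Gamma> s \<Longrightarrow> sub_q s q \<in> reducible_q A)"
  "e_typing \<Gamma> \<delta> u \<Longrightarrow>
    (\<And>s c. reducible_env \<Gamma> s \<Longrightarrow> reducible_decl \<delta> c \<Longrightarrow> SN (sub_e s c u))"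
proof (induction rule: p_typing_t_typing_q_typing_e_typing.inducts)
  case (ty_PVar i \<Gamma>)
  then show ?case
    by (simp add: reducible_env_def)
next
  case (ty_TVar \<Gamma> A)
  then show ?case
    by simp
next
  case (ty_Star \<Gamma> A)
  show ?case
    by (simp add: Star_reducible_t)
next
  case (ty_PLamXK A \<Gamma> B u)
  have "SN (Cut (TPair p t) (PLamXK (sub_e (up_sub s) TVar u)))"
    if "p \<in> reducible_p A" "t \<in> reducible_t B" for p t
    using that ty_PLamXK by (intro SN_Cut_PLamXK) (simp add: inst_xk_sub reducible_env_Cons)
  \<comment> \<open>The remaining value \<open>Star\<close> is stuck against
    \<open>PLamXK\<close>.\<close>
  then have "SN (Cut t (PLamXK (sub_e (up_sub s) TVar u)))" if "t \<in> val_t (Arrow A B)" for t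
    using that unfolding val_t_Arrow by (auto simp: SN_Cut_Star_PLamXK)
  then show ?case
    unfolding reducible_p_def[of "Arrow A B"] by (simp add: orth_p_def)
next
  case (ty_TPair \<Gamma> p A \<delta> t B)
  then have "sub_t s c (TPair p t) \<in> val_t (Arrow A B)"
    unfolding val_t_Arrow by simp
  then show ?case
    using val_t_subset_reducible_t by blast
next
  case (ty_PLamK \<Gamma> A u)
  \<comment> \<open>Testing on values only is essential here: it supplies the shape that
    \<open>SN_Cut_PLamK\<close> demands, while the inclusion in \<open>reducible_t A\<close> makes
    the induction hypothesis applicable.\<close>
  have "SN (Cut t (PLamK (sub_e s TVar u)))" if "t \<in> val_t A" for t
  proof (rule SN_Cut_PLamK)
    have "t \<in> reducible_t A"
      using that val_t_subset_reducible_t by blast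
    then show "SN (inst_k t (sub_e s TVar u))"
      using ty_PLamK by (simp add: inst_k_sub)
  qed (use that val_t_cases in blast)
  then show ?case
    by (simp add: reducible_p_def orth_p_def)
next
  case (ty_TLam A \<Gamma> \<delta> u)
  \<comment> \<open>\<open>TLam\<close> has priority over every p-term, so \<open>p\<close> may be
    an arbitrary reducible one; it becomes the new entry of the substitution.\<close>
  have "SN (Cut (TLam (sub_e (up_sub s) (ren_t Suc c) u)) p)" if "p \<in> reducible_p A" for p
    using that ty_TLam by (intro SN_Cut_TLam) (simp add: inst_x_sub reducible_env_Cons)
  then show ?case
    by (simp add: reducible_t_def orth_t_def)
next
  case (ty_QLam \<Gamma> A u)
  then show ?case
    by (auto simp: reducible_q_def inst_k_sub intro!: SN_App_QLam)
next
  case (ty_Cut \<Gamma> p A \<delta> t)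
  then show ?case
    by (auto intro: SN_Cut_reducible)
next
  case (ty_App \<Gamma> q A \<delta> t)
  then show ?case
    by (simp add: reducible_q_def)
qed

theorem theorem1:
  fixes u :: eterm
  assumes "well_typed u" and "t_closed u"
  shows "\<not> (\<exists>f :: nat \<Rightarrow> eterm. f 0 = u \<and> (\<forall>i. red (f i) (f (Suc i))))"
proof -
  obtain \<Gamma> \<delta> where u: "e_typing \<Gamma> \<delta> u"
    using assms(1) by (auto simp: well_typed_def)
  \<comment> \<open>Variables of both kinds are reducible, so the identity substitution is
    admissible even for a nonempty environment.\<close>
  have "reducible_env \<Gamma> PVar"
    by (simp add: reducible_env_def PVar_reducible_p)
  moreover have "reducible_decl \<delta> TVar"
    by (cases \<delta>) (simp_all add: TVar_reducible_t)
  ultimately have "SN (sub_e PVar TVar u)"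
    using typing_reducible(4)[OF u] by blast
  then show ?thesis
    by (intro SN_no_infinite_reduction) (simp add: sub_PVar_TVar)
qed

end
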